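(* Let $n\geq 0$, let $f(m)=2^{2^m}$, and let $$P_n=\Big\{(a,b,c)\in\mathbb{N}^3 : ab=c \text{ and } a,b,c<\prod_{p \text{ prime},\ p<f(n+2)} p\Big\}.$$ Then every deterministic word automaton representing $P_n$ has at least $2^{\lfloor f(n+1)/(2\log_2\varrho)\rfloor}$ states.
   Context: $P_n$ is the set defined by the Fischer–Rabin Presburger formula $\mathrm{Prod}_n(x,y,z)$ (of length linear in $n$). Encoding: fix an integer base $\varrho\geq 2$ and $\Sigma=\{0,\dots,\varrho-1\}$. For $b_{n-1}\dots b_0\in\Sigma^*$ let $\langle b_{n-1}\dots b_0\rangle_{\mathbb N}=\sum_{i<n}\varrho^i b_i$; for $b_nb_{n-1}\dots b_0\in\Sigma^+$ let $\langle b_n\dots b_0\rangle_{\mathbb Z}=\langle b_{n-1}\dots b_0\rangle_{\mathbb N}$ if $b_n=0$ and $\langle b_{n-1}\dots b_0\rangle_{\mathbb N}-\varrho^n$ if $b_n\neq 0$. A word over $\Sigma^3$ is read componentwise (track $i$ encodes the $i$th integer), giving $\langle w\rangle_{\mathbb Z}\in\mathbb{Z}^3$ for $w\in(\Sigma^3)^+$. A deterministic word automaton $\mathcal A$ over $\Sigma^3$ represents $U\subseteq\mathbb{Z}^3$ if $L(\mathcal A)=\{w\in(\Sigma^3)^+:\langle w\rangle_{\mathbb Z}\in U\}$. *)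

theory Defs
  imports Complex_Main "HOL-Computational_Algebra.Primes"
begin

text \<open>
  Digit words are lists of naturals, most significant digit first. In an integer encoding the
  head of the list is the sign digit: any nonzero digit there means negative.
\<close>

definition nat_value :: "nat \<Rightarrow> nat list \<Rightarrow> nat" where
  "nat_value \<rho> bs = (\<Sum>i<length bs. \<rho> ^ i * rev bs ! i)"

text \<open>Only meaningful for nonempty words.\<close>

definition int_value :: "nat \<Rightarrow> nat list \<Rightarrow> int" where
  "int_value \<rho> bs =
     (if hd bs = 0 then int (nat_value \<rho> (tl bs))
      else int (nat_value \<rho> (tl bs)) - int \<rho> ^ length (tl bs))"

definition digits :: "nat \<Rightarrow> nat set" where
  "digits \<rho> = {..<\<rho>}"

definition letters3 :: "nat \<Rightarrow> (nat \<times> nat \<times> nat) set" where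
  "letters3 \<rho> = digits \<rho> \<times> digits \<rho> \<times> digits \<rho>"

definition int_value3 :: "nat \<Rightarrow> (nat \<times> nat \<times> nat) list \<Rightarrow> int \<times> int \<times> int" where
  "int_value3 \<rho> w =
     (int_value \<rho> (map (\<lambda>(x, y, z). x) w),
      int_value \<rho> (map (\<lambda>(x, y, z). y) w),
      int_value \<rho> (map (\<lambda>(x, y, z). z) w))"

record ('q, 'a) dwa =
  states :: "'q set"
  start :: "'q"
  trans_fun :: "'q \<Rightarrow> 'a \<Rightarrow> 'q"
  accepting :: "'q set"

definition is_dwa :: "'a set \<Rightarrow> ('q, 'a) dwa \<Rightarrow> bool" where
  "is_dwa \<Sigma> A \<longleftrightarrow>
     finite (states A) \<and> start A \<in> states A \<and> accepting A \<subseteq> states A \<and>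
     (\<forall>q\<in>states A. \<forall>a\<in>\<Sigma>. trans_fun A q a \<in> states A)"

definition language :: "'a set \<Rightarrow> ('q, 'a) dwa \<Rightarrow> 'a list set" where
  "language \<Sigma> A = {w \<in> lists \<Sigma>. foldl (trans_fun A) (start A) w \<in> accepting A}"

text \<open>The empty word encodes no triple, so a representing automaton must reject it.\<close>

definition represents :: "nat \<Rightarrow> ('q, nat \<times> nat \<times> nat) dwa \<Rightarrow> (int \<times> int \<times> int) set \<Rightarrow> bool" where
  "represents \<rho> A U \<longleftrightarrow>
     language (letters3 \<rho>) A = {w \<in> lists (letters3 \<rho>). w \<noteq> [] \<and> int_value3 \<rho> w \<in> U}"

definition dbl_exp :: "nat \<Rightarrow> nat" where
  "dbl_exp m = 2 ^ (2 ^ m)"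

definition prod_bound :: "nat \<Rightarrow> nat" where
  "prod_bound n = (\<Prod>p | prime p \<and> p < dbl_exp (n + 2). p)"

definition prod_set :: "nat \<Rightarrow> (int \<times> int \<times> int) set" where
  "prod_set n = {(int a, int b, int c) | a b c.
            a * b = c \<and> a < prod_bound n \<and> b < prod_bound n \<and> c < prod_bound n}"

end

theory Submission
  imports Defs
begin

text \<open>
  Write \<open>F = dbl_exp (n + 1)\<close> and \<open>k = \<lfloor>F / (2 log\<^sub>2 \<rho>)\<rfloor>\<close>. Chebyshev's lower bound, in Nair's form
  \<open>4 ^ m \<le> lcm (1, \<dots>, 2 m + 1)\<close>, gives at least \<open>F\<close> primes below \<open>F\<^sup>2 = dbl_exp (n + 2)\<close>, so
  that \<open>\<rho> ^ (2 k) \<le> 2 ^ F \<le> prod_bound n\<close>. For \<open>u, v < \<rho> ^ k\<close>, extend a prefix encoding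
  \<open>(0, 1, u)\<close> by \<open>k\<close> letters encoding \<open>(v, 0, 0)\<close>: the result encodes
  \<open>(v, \<rho> ^ k, u \<rho> ^ k)\<close>, which lies in \<open>prod_set n\<close> iff \<open>u = v\<close>. Hence these
  \<open>\<rho> ^ k \<ge> 2 ^ k\<close> prefixes lead to distinct states.
\<close>

section \<open>A lower bound for the number of primes\<close>

text \<open>Leibniz' harmonic triangle: \<open>1 / z = 1 / x - 1 / y\<close> for the entries \<open>x, y, z\<close> of the proof.\<close>

lemma Suc_mult_binomial_dvd_Lcm:
  assumes "k \<le> n"
  shows "Suc n * (n choose k) dvd Lcm {1..Suc n}"
  using assms
proof (induction k arbitrary: n)
  case 0
  show ?case by (simp add: dvd_Lcm)
next
  case (Suc k)
  then obtain n' where n: "n = Suc n'" and k: "k \<le> n'"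
    by (cases n) auto
  define x y z L where "x = Suc n' * (n' choose k)" and "y = Suc n * (n choose k)"
    and "z = Suc n * (n choose Suc k)" and "L = Lcm {1..Suc n}"
  have pos: "x > 0" "y > 0"
    using k n by (simp_all add: x_def y_def)
  have "Suc k * z = Suc n * x"
    unfolding x_def z_def n using Suc_times_binomial_eq[of n' k] by (simp only: ac_simps)
  then have z: "int (Suc k) * int z = int (Suc n) * int x"
    by (metis of_nat_mult)
  have "(Suc n' - k) * y = Suc n * x"
    unfolding x_def y_def n using binomial_absorb_comp[of "Suc n'" k]
    by (simp only: ac_simps diff_Suc_1)
  then have y: "(int (Suc n) - int (Suc k)) * int y = int (Suc n) * int x"
    using k n by (metis Suc_diff_le Suc_le_mono diff_Suc_Suc le_Suc_eq of_nat_diff of_nat_mult)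
  \<comment> \<open>Adding the absorption identities for \<open>y\<close> and \<open>z\<close>
    eliminates \<open>k\<close> and leaves \<open>1 / x = 1 / y + 1 / z\<close>, cleared of
    denominators. The integers make the later subtraction safe.\<close>
  have "int (Suc n) * (int x * (int y + int z)) = int (Suc n) * (int y * int z)"
    using y z by algebra
  then have xyz: "int x * (int y + int z) = int y * int z"
    by (metis mult_left_cancel of_nat_eq_0_iff nat.distinct(1))
  have "x dvd Lcm {1..Suc n'}"
    unfolding x_def using Suc.IH[OF k] .
  also have "\<dots> dvd L"
    unfolding L_def n by (intro Lcm_subset) auto
  finally obtain a where a: "L = x * a" ..
  have "y dvd L"
    unfolding y_def L_def using Suc by simp
  then obtain b where b: "L = y * b" ..
  have a': "int L = int x * int a"
    by (simp add: a)
  have b': "int L = int y * int b"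
    by (simp add: b)
  \<comment> \<open>In quotients this reads \<open>L / z = L / x - L / y = a - b\<close>, so
    \<open>L / z\<close> is an integer.\<close>
  have "int x * int y * (int z * (int a - int b)) = int x * int y * int L"
    using xyz a' b' by algebra
  then have "int L = int z * (int a - int b)"
    using pos by simp
  then have "z dvd L"
    by (metis dvd_triv_left int_dvd_int_iff)
  then show ?case
    by (simp add: z_def L_def)
qed

text \<open>Each prime \<open>p \<le> x\<close> enters the lcm with its largest power not exceeding
  \<open>x\<close>, hence contributes a factor of at most \<open>x\<close>.\<close>

lemma Lcm_atLeastAtMost_le_power:
  fixes x :: nat
  shows "Lcm {1..x} \<le> x ^ card {p. prime p \<and> p \<le> x}"
proof -
  define P where "P = {p. prime p \<and> p \<le> x}"
  have fin: "finite P"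
    by (simp add: P_def)
  have "\<exists>e. p ^ e \<le> x \<and> x < p ^ (e + 1)" if "p \<in> P" for p
    using that ex_power_ivl1[of p x] prime_ge_2_nat[of p] by (simp add: P_def)
  then obtain e where e: "\<And>p. p \<in> P \<Longrightarrow> p ^ e p \<le> x \<and> x < p ^ (e p + 1)"
    by metis
  have "j dvd (\<Prod>p\<in>P. p ^ e p)" if j: "j \<in> {1..x}" for j
  proof -
    have "j = (\<Prod>p\<in>prime_factors j. p ^ multiplicity p j)"
      using j by (intro prime_factorization_nat) auto
    also have "\<dots> dvd (\<Prod>p\<in>P. p ^ e p)"
    proof (rule prod_dvd_prod_subset2[OF fin])
      show sub: "prime_factors j \<subseteq> P"
        using j by (auto simp: P_def prime_factors_dvd dest!: dvd_imp_le)
      fix p assume p: "p \<in> prime_factors j"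
      have "p ^ multiplicity p j \<le> j"
        using j by (intro dvd_imp_le multiplicity_dvd) auto
      also have "\<dots> < p ^ (e p + 1)"
        using e[of p] sub p j by (meson atLeastAtMost_iff le_less_trans subsetD)
      finally have "multiplicity p j < e p + 1"
        by (rule power_less_imp_less_exp[rotated]) (rule prime_gt_1_nat[OF in_prime_factors_imp_prime[OF p]])
      then show "p ^ multiplicity p j dvd p ^ e p"
        by (simp add: le_imp_power_dvd)
    qed
    finally show ?thesis .
  qed
  then have "Lcm {1..x} dvd (\<Prod>p\<in>P. p ^ e p)"
    by (rule Lcm_least)
  moreover have "(\<Prod>p\<in>P. p ^ e p) > 0"
    by (intro prod_pos) (auto simp: P_def prime_gt_0_nat)
  ultimately have "Lcm {1..x} \<le> (\<Prod>p\<in>P. p ^ e p)"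
    by (rule dvd_imp_le)
  also have "\<dots> \<le> (\<Prod>p\<in>P. x)"
    using e by (intro prod_mono) auto
  finally show ?thesis
    by (simp add: P_def)
qed

text \<open>The central coefficient is the largest of the \<open>2 * m + 1\<close> entries of a row
  with sum \<open>4 ^ m\<close>. Multiplied by \<open>2 * m + 1\<close>, it is therefore at least
  \<open>4 ^ m\<close>, and this multiple divides the lcm.\<close>

lemma four_power_le_power_card_primes:
  "4 ^ m \<le> Suc (2 * m) ^ card {p. prime p \<and> p \<le> Suc (2 * m)}"
proof -
  have "(2::nat) ^ (2 * m) = (\<Sum>k\<le>2 * m. (2 * m) choose k)"
    by (simp add: choose_row_sum)
  also have "\<dots> \<le> (\<Sum>k\<le>2 * m. (2 * m) choose m)"
    by (intro sum_mono binomial_maximum')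
  also have "\<dots> = Suc (2 * m) * ((2 * m) choose m)"
    by simp
  also have "\<dots> \<le> Lcm {1..Suc (2 * m)}"
  proof (rule dvd_imp_le)
    show "Suc (2 * m) * ((2 * m) choose m) dvd Lcm {1..Suc (2 * m)}"
      by (rule Suc_mult_binomial_dvd_Lcm) simp
    have "Lcm {1..Suc (2 * m)} \<noteq> 0"
      by (subst Lcm_0_iff_nat) auto
    then show "Lcm {1..Suc (2 * m)} > 0"
      by (simp only: neq0_conv)
  qed
  also have "\<dots> \<le> Suc (2 * m) ^ card {p. prime p \<and> p \<le> Suc (2 * m)}"
    by (rule Lcm_atLeastAtMost_le_power)
  finally show ?thesis
    by (simp add: power_mult)
qed

lemma dbl_exp_Suc: "dbl_exp (Suc m) = (dbl_exp m)\<^sup>2"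
  by (simp add: dbl_exp_def power_mult [symmetric] mult.commute)

lemma card_primes_less_dbl_exp:
  "dbl_exp (n + 1) \<le> card {p. prime p \<and> p < dbl_exp (n + 2)}"
proof -
  define F where "F = dbl_exp (n + 1)"
  define c where "c = card {p. prime p \<and> p < dbl_exp (n + 2)}"
  \<comment> \<open>Since \<open>F\<close> is even, this makes \<open>2 * m + 1 = F^2 - 1\<close>,
    so the primes up to \<open>2 * m + 1\<close> are exactly those below \<open>F^2\<close>.\<close>
  define m where "m = F\<^sup>2 div 2 - 1"
  have FF: "dbl_exp (n + 2) = F\<^sup>2"
    using dbl_exp_Suc[of "n + 1"] by (simp add: F_def)
  have "F = (dbl_exp n)\<^sup>2" and ge2: "dbl_exp n \<ge> 2"
    using dbl_exp_Suc[of n] self_le_power[of 2 "2 ^ n"] by (auto simp: F_def dbl_exp_def)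
  then have F4: "F \<ge> 4"
    using power_mono[OF ge2, of 2] by simp
  have "even F"
    by (simp add: F_def dbl_exp_def)
  then have "even (F\<^sup>2)" by simp
  moreover have F16: "F\<^sup>2 \<ge> 16"
    using power_mono[OF F4, of 2] by simp
  ultimately have m: "Suc (2 * m) = F\<^sup>2 - 1" "2 * m = F\<^sup>2 - 2" "F\<^sup>2 > 0"
    unfolding m_def using F16 by (presburger, presburger, linarith)
  have "{p. prime p \<and> p < dbl_exp (n + 2)} = {p. prime p \<and> p \<le> Suc (2 * m)}"
    unfolding FF using m by auto
  then have c: "c = card {p. prime p \<and> p \<le> Suc (2 * m)}"
    by (simp add: c_def)
  have "(2::nat) ^ (F\<^sup>2 - 2) = 4 ^ m"
    by (simp flip: m(2) add: power_mult)
  also have "\<dots> \<le> Suc (2 * m) ^ c"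
    unfolding c by (rule four_power_le_power_card_primes)
  also have "\<dots> \<le> dbl_exp (n + 2) ^ c"
    unfolding FF using m by (intro power_mono) auto
  also have "\<dots> = 2 ^ (2 ^ (n + 2) * c)"
    by (simp only: dbl_exp_def power_mult)
  finally have "F\<^sup>2 - 2 \<le> 2 ^ (n + 2) * c"
    by simp
  also have "\<dots> \<le> F * c"
  proof -
    \<comment> \<open>\<open>F\<close> is 2 to the power \<open>2 ^ (n + 1)\<close>, and this
      exponent is at least \<open>n + 2\<close>.\<close>
    have "n + 1 < 2 ^ (n + 1)"
      by (rule less_exp)
    then have "(2::nat) ^ (n + 2) \<le> F"
      unfolding F_def dbl_exp_def by (intro power_increasing) auto
    then show ?thesis
      by (rule mult_right_mono) simp
  qed
  finally have le: "F\<^sup>2 - 2 \<le> F * c" .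
  have "F \<le> c"
  proof (rule ccontr)
    \<comment> \<open>Then \<open>F * c \<le> F^2 - F\<close>, which is below \<open>F^2 - 2\<close>
      because \<open>F \<ge> 4\<close>.\<close>
    assume "\<not> F \<le> c"
    then have "F * (c + 1) \<le> F * F"
      by (intro mult_left_mono) auto
    then show False
      using le F4 by (simp add: power2_eq_square)
  qed
  then show ?thesis
    by (simp add: F_def c_def)
qed

lemma two_power_le_prod_bound: "2 ^ dbl_exp (n + 1) \<le> prod_bound n"
proof -
  have "(2::nat) ^ dbl_exp (n + 1) \<le> 2 ^ card {p::nat. prime p \<and> p < dbl_exp (n + 2)}"
    using card_primes_less_dbl_exp by (intro power_increasing) auto
  also have "\<dots> = (\<Prod>p | prime p \<and> p < dbl_exp (n + 2). 2)"
    by simp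
  also have "\<dots> \<le> prod_bound n"
    unfolding prod_bound_def by (intro prod_mono) (auto simp: prime_ge_2_nat)
  finally show ?thesis .
qed

section \<open>Distinguishable prefixes\<close>

lemma nat_value_Cons: "nat_value \<rho> (b # bs) = b * \<rho> ^ length bs + nat_value \<rho> bs"
  by (simp add: nat_value_def nth_append)

lemma nat_value_append:
  "nat_value \<rho> (bs @ cs) = nat_value \<rho> bs * \<rho> ^ length cs + nat_value \<rho> cs"
proof (induction bs)
  case Nil
  show ?case by (simp add: nat_value_def)
qed (simp add: nat_value_Cons power_add algebra_simps)

lemma int_value_0_Cons [simp]: "int_value \<rho> (0 # bs) = int (nat_value \<rho> bs)"
  by (simp add: int_value_def)

text \<open>The length is fixed at \<open>s\<close>, with zero padding or truncation, so that a
  suffix shifts every prefix by the same power of \<open>\<rho>\<close>.\<close>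

definition digit_word :: "nat \<Rightarrow> nat \<Rightarrow> nat \<Rightarrow> nat list" where
  "digit_word \<rho> s x = map (\<lambda>i. x div \<rho> ^ i mod \<rho>) (rev [0..<s])"

lemma length_digit_word [simp]: "length (digit_word \<rho> s x) = s"
  by (simp add: digit_word_def)

lemma nat_value_digit_word: "nat_value \<rho> (digit_word \<rho> s x) = x mod \<rho> ^ s"
proof (induction s)
  case 0
  show ?case by (simp add: digit_word_def nat_value_def)
next
  case (Suc s)
  have "digit_word \<rho> (Suc s) x = (x div \<rho> ^ s mod \<rho>) # digit_word \<rho> s x"
    by (simp add: digit_word_def)
  then have "nat_value \<rho> (digit_word \<rho> (Suc s) x) = (x div \<rho> ^ s mod \<rho>) * \<rho> ^ s + x mod \<rho> ^ s"
    by (simp add: nat_value_Cons Suc)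
  also have "\<dots> = x mod \<rho> ^ Suc s"
    by (simp add: mod_mult2_eq power_Suc2 del: power_Suc)
  finally show ?case .
qed

definition digit_word3 :: "nat \<Rightarrow> nat \<Rightarrow> nat \<times> nat \<times> nat \<Rightarrow> (nat \<times> nat \<times> nat) list" where
  "digit_word3 \<rho> s = (\<lambda>(x, y, z).
     map (\<lambda>i. (x div \<rho> ^ i mod \<rho>, y div \<rho> ^ i mod \<rho>, z div \<rho> ^ i mod \<rho>)) (rev [0..<s]))"

lemma digit_word3_in_lists:
  assumes "\<rho> > 0"
  shows "digit_word3 \<rho> s xyz \<in> lists (letters3 \<rho>)"
  using assms by (auto simp: digit_word3_def letters3_def digits_def split: prod.splits)

lemma map_digit_word3:
  "map (\<lambda>(x, y, z). x) (digit_word3 \<rho> s (a, b, c)) = digit_word \<rho> s a"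
  "map (\<lambda>(x, y, z). y) (digit_word3 \<rho> s (a, b, c)) = digit_word \<rho> s b"
  "map (\<lambda>(x, y, z). z) (digit_word3 \<rho> s (a, b, c)) = digit_word \<rho> s c"
  by (simp_all add: digit_word3_def digit_word_def)

lemma int_value3_digit_word3_append:
  "int_value3 \<rho> ((0, 0, 0) # digit_word3 \<rho> s (a, b, c) @ digit_word3 \<rho> t (a', b', c')) =
     (int (a mod \<rho> ^ s * \<rho> ^ t + a' mod \<rho> ^ t),
      int (b mod \<rho> ^ s * \<rho> ^ t + b' mod \<rho> ^ t),
      int (c mod \<rho> ^ s * \<rho> ^ t + c' mod \<rho> ^ t))"
  by (simp add: int_value3_def map_digit_word3 nat_value_append nat_value_digit_word)

lemma foldl_trans_fun_in_states:
  assumes "is_dwa \<Sigma> A" and "q \<in> states A" and "w \<in> lists \<Sigma>"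
  shows "foldl (trans_fun A) q w \<in> states A"
  using assms(3,2) by (induction w arbitrary: q) (use assms(1) in \<open>auto simp: is_dwa_def\<close>)

text \<open>If \<open>pre u\<close> and \<open>pre v\<close> led to the same state,
  \<open>suf v\<close> would be accepted after both or after neither. It is accepted after
  \<open>pre v\<close>, so \<open>u = v\<close>.\<close>

lemma card_fooling_set_le_card_states:
  assumes A: "is_dwa \<Sigma> A"
    and pre: "\<And>u. u \<in> I \<Longrightarrow> pre u \<in> lists \<Sigma>"
    and suf: "\<And>u. u \<in> I \<Longrightarrow> suf u \<in> lists \<Sigma>"
    and fooling: "\<And>u v. u \<in> I \<Longrightarrow> v \<in> I \<Longrightarrow> pre u @ suf v \<in> language \<Sigma> A \<longleftrightarrow> u = v"
  shows "card I \<le> card (states A)"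
proof (rule card_inj_on_le)
  show "inj_on (\<lambda>u. foldl (trans_fun A) (start A) (pre u)) I"
  proof (rule inj_onI)
    fix u v
    assume uv: "u \<in> I" "v \<in> I"
      and eq: "foldl (trans_fun A) (start A) (pre u) = foldl (trans_fun A) (start A) (pre v)"
    have "pre u @ suf v \<in> language \<Sigma> A \<longleftrightarrow> pre v @ suf v \<in> language \<Sigma> A"
      using pre suf uv eq by (simp add: language_def)
    then show "u = v"
      using fooling uv by blast
  qed
  show "(\<lambda>u. foldl (trans_fun A) (start A) (pre u)) ` I \<subseteq> states A"
    using A foldl_trans_fun_in_states[OF A _ pre] by (auto simp: is_dwa_def)
  show "finite (states A)"
    using A by (simp add: is_dwa_def)
qed

lemma power_le_card_states:
  assumes \<rho>: "\<rho> \<ge> 2"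
    and A: "is_dwa (letters3 \<rho>) A"
    and rep: "represents \<rho> A (prod_set n)"
    and bound: "\<rho> ^ (2 * k) \<le> prod_bound n"
  shows "\<rho> ^ k \<le> card (states A)"
proof -
  \<comment> \<open>The letter \<open>(0, 0, 0)\<close> is the sign, making all components
    nonnegative. The length is \<open>k + 1\<close> because for \<open>k = 0\<close> the digit 1 of
    the second track would not fit into \<open>k\<close> digits.\<close>
  define pre where "pre u = (0, 0, 0) # digit_word3 \<rho> (k + 1) (0, 1, u)" for u
  define suf where "suf v = digit_word3 \<rho> k (v, 0, 0)" for v
  \<comment> \<open>The second factor \<open>\<rho> ^ k\<close> must be strictly below the bound.
    For \<open>k = 0\<close> the assumption yields only \<open>1 \<le> prod_bound n\<close>, hence
    the case split.\<close>
  have small: "\<rho> ^ k < prod_bound n"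
  proof (cases k)
    case 0
    have "(1::nat) < 2 ^ dbl_exp (n + 1)"
      by (rule one_less_power) (auto simp: dbl_exp_def)
    also have "\<dots> \<le> prod_bound n"
      by (rule two_power_le_prod_bound)
    finally show ?thesis
      using 0 by simp
  next
    case (Suc j)
    then have "\<rho> ^ k < \<rho> ^ (2 * k)"
      using \<rho> by (intro power_strict_increasing) auto
    then show ?thesis
      using bound by simp
  qed
  have mono: "\<rho> ^ k \<le> \<rho> ^ (k + 1)"
    using \<rho> by (intro power_increasing) auto
  have one_mod: "1 mod \<rho> ^ (k + 1) = 1"
    using \<rho> by (intro mod_less one_less_power) auto
  have in_lists: "pre u \<in> lists (letters3 \<rho>)" "suf u \<in> lists (letters3 \<rho>)" for u
    using \<rho> digit_word3_in_lists[of \<rho>] by (auto simp: pre_def suf_def letters3_def digits_def)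
  have "pre u @ suf v \<in> language (letters3 \<rho>) A \<longleftrightarrow> u = v"
    if u: "u < \<rho> ^ k" and v: "v < \<rho> ^ k" for u v
  proof -
    have encodes: "int_value3 \<rho> (pre u @ suf v) = (int v, int (\<rho> ^ k), int (u * \<rho> ^ k))"
      unfolding pre_def suf_def append_Cons int_value3_digit_word3_append
      using u v less_le_trans[OF u mono] one_mod \<rho> by (simp del: power_Suc)
    \<comment> \<open>The true product of the first two components stays below the bound, so
      membership depends only on whether the third component equals it. This is where the exponent
      \<open>2 * k\<close> is used.\<close>
    have "v * \<rho> ^ k < \<rho> ^ k * \<rho> ^ k"
      using v \<rho> by (intro mult_strict_right_mono) auto
    also have "\<dots> = \<rho> ^ (2 * k)"
      by (simp add: mult_2 power_add)
    finally have "v * \<rho> ^ k < prod_bound n"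
      using bound by simp
    then have "(int v, int (\<rho> ^ k), int (u * \<rho> ^ k)) \<in> prod_set n \<longleftrightarrow> v * \<rho> ^ k = u * \<rho> ^ k"
      using small v unfolding prod_set_def by (auto simp del: of_nat_power of_nat_mult)
    also have "\<dots> \<longleftrightarrow> u = v"
      using \<rho> by auto
    finally have "int_value3 \<rho> (pre u @ suf v) \<in> prod_set n \<longleftrightarrow> u = v"
      by (simp only: encodes)
    moreover have "pre u @ suf v \<in> lists (letters3 \<rho>)" "pre u @ suf v \<noteq> []"
      using in_lists by (auto simp: pre_def)
    ultimately show ?thesis
      using rep unfolding represents_def by blast
  qed
  then have "card {..<\<rho> ^ k} \<le> card (states A)"
    using in_lists by (intro card_fooling_set_le_card_states[OF A, of _ pre suf]) auto
  then show ?thesis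
    by simp
qed

theorem theorem5p3:
  fixes n \<rho> :: nat
    and A :: "('q, nat \<times> nat \<times> nat) dwa"
  assumes "\<rho> \<ge> 2"
    and "is_dwa (letters3 \<rho>) A"
    and "represents \<rho> A (prod_set n)"
  shows "card (states A) \<ge> 2 ^ nat \<lfloor>real (dbl_exp (n + 1)) / (2 * log 2 (real \<rho>))\<rfloor>"
proof -
  define F where "F = dbl_exp (n + 1)"
  define k where "k = nat \<lfloor>real F / (2 * log 2 (real \<rho>))\<rfloor>"
  have log: "log 2 (real \<rho>) > 0"
    using assms(1) by simp
  have "real k \<le> real F / (2 * log 2 (real \<rho>))"
    unfolding k_def using log by (intro of_nat_floor) simp
  \<comment> \<open>The factor 2 in the denominator of the exponent is exactly what allows
    \<open>2 * k\<close> digits in base \<open>\<rho>\<close> within \<open>2 ^ F\<close>.\<close>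
  then have "real (2 * k) * log 2 (real \<rho>) \<le> real F"
    using log by (simp add: field_simps)
  then have "log 2 (real \<rho> ^ (2 * k)) \<le> log 2 (2 ^ F)"
    using assms(1) by (simp add: log_nat_power)
  then have "real \<rho> ^ (2 * k) \<le> 2 ^ F"
    using assms(1) by (subst (asm) log_le_cancel_iff) auto
  then have "\<rho> ^ (2 * k) \<le> 2 ^ F"
    by (metis of_nat_le_iff of_nat_numeral of_nat_power)
  also have "\<dots> \<le> prod_bound n"
    unfolding F_def by (rule two_power_le_prod_bound)
  finally have "\<rho> ^ k \<le> card (states A)"
    by (rule power_le_card_states[OF assms])
  moreover have "2 ^ k \<le> \<rho> ^ k"
    using assms(1) by (rule power_mono) simp
  ultimately show ?thesis
    unfolding k_def F_def by linarith
qed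

end
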